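(* Let $R$ be an integral domain, $X$ an indeterminate over $R$, and $*$ a star operation of finite character on $R[X]$. The following statements are equivalent: (i) every upper to zero in $R[X]$ is $*$-maximal; (ii) $R$ is a UMT-domain and $t\text{-}\mathrm{Max}(R[X])=*\text{-}\mathrm{Max}(R[X])$.
   Context: For an integral domain $D$ with quotient field $L$, $\bar F(D)$ is the set of nonzero $D$-submodules of $L$, $F(D)$ the set of nonzero fractional ideals of $D$ (those $E\in\bar F(D)$ with $dE\subseteq D$ for some $0\ne d\in D$), and $f(D)$ the set of nonzero finitely generated $D$-submodules of $L$. A semistar operation on $D$ is a map $*:\bar F(D)\to\bar F(D)$, $E\mapsto E^*$, such that for all $E,F\in\bar F(D)$ and $0\ne a\in L$: $(aE)^*=aE^*$; $E\subseteq E^*$, and $E\subseteq F$ implies $E^*\subseteq F^*$; $E^{**}=E^*$. If $D^*=D$, the restriction of $*$ to $F(D)$ is called a star operation on $D$. A star operation is of finite character if $E^*=\bigcup\{F^* : F\in f(D), F\subseteq E\}$ for all $E\in F(D)$. A nonzero ideal $I$ is a $*$-ideal if $I=I^*$; a $*$-prime ideal is a prime ideal that is a $*$-ideal; a $*$-maximal ideal is a $*$-prime ideal that is maximal with respect to inclusion among $*$-prime ideals. $*\text{-}\mathrm{Max}(D)$ is the set of $*$-maximal ideals of $D$. The $v$-operation is $E_v=(D:(D:E))$, where $(D:E)=\{x\in L: xE\subseteq D\}$, and the $t$-operation is $E_t=\bigcup\{F_v: F\in f(D),F\subseteq E\}$; it is a star operation of finite character. Let $K$ be the quotient field of $R$.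 An upper to zero in $R[X]$ is a prime ideal of the form $fK[X]\cap R[X]$ with $f\in K[X]$ irreducible. $R$ is a UMT-domain if every upper to zero in $R[X]$ is a $t$-maximal ideal of $R[X]$. *)

theory Defs
  imports "HOL-Computational_Algebra.Computational_Algebra"
begin

text \<open>
  An integral domain \<open>D\<close> is a type \<open>'d\<close> of class \<^class>\<open>idom\<close>, its quotient field \<open>L\<close> is the type
  \<open>'d fract\<close>, and \<open>D\<close> is viewed inside \<open>L\<close> as \<open>range to_fract\<close>. Thus \<open>R[X]\<close> is the type \<open>'r poly\<close>
  and \<open>K[X]\<close> is \<open>'r fract poly\<close>. The structure of \<open>L\<close> as a \<open>D\<close>-module and of \<open>D\<close> as a module over
  itself are instances of the library locale \<open>module\<close>.
\<close>

abbreviation fract_scale :: "'d::idom \<Rightarrow> 'd fract \<Rightarrow> 'd fract" where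
  "fract_scale d x \<equiv> to_fract d * x"

lemma module_fract: "module (fract_scale :: 'd::idom \<Rightarrow> 'd fract \<Rightarrow> 'd fract)"
  by unfold_locales (simp_all add: algebra_simps)

lemma module_self: "module ((*) :: 'd::idom \<Rightarrow> 'd \<Rightarrow> 'd)"
  by unfold_locales (simp_all add: algebra_simps)

definition nonzero_submodules :: "'d::idom fract set set" where
  "nonzero_submodules = {E. module.subspace fract_scale E \<and> E \<noteq> {0}}"

definition fractional_ideals :: "'d::idom fract set set" where
  "fractional_ideals =
     {E \<in> nonzero_submodules. \<exists>d::'d. d \<noteq> 0 \<and> fract_scale d ` E \<subseteq> range to_fract}"

definition fg_submodules :: "'d::idom fract set set" where
  "fg_submodules = {E \<in> nonzero_submodules. \<exists>S. finite S \<and> E = module.span fract_scale S}"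

definition semistar_operation :: "('d::idom fract set \<Rightarrow> 'd fract set) \<Rightarrow> bool" where
  "semistar_operation s \<longleftrightarrow>
     (\<forall>E\<in>nonzero_submodules. s E \<in> nonzero_submodules) \<and>
     (\<forall>E\<in>nonzero_submodules. \<forall>a. a \<noteq> 0 \<longrightarrow> s ((*) a ` E) = (*) a ` s E) \<and>
     (\<forall>E\<in>nonzero_submodules. E \<subseteq> s E) \<and>
     (\<forall>E\<in>nonzero_submodules. \<forall>F\<in>nonzero_submodules. E \<subseteq> F \<longrightarrow> s E \<subseteq> s F) \<and>
     (\<forall>E\<in>nonzero_submodules. s (s E) = s E)"

text \<open>Only the values of a star operation on fractional ideals are meaningful.\<close>

definition star_operation :: "('d::idom fract set \<Rightarrow> 'd fract set) \<Rightarrow> bool" where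
  "star_operation s \<longleftrightarrow>
     (\<exists>s'. semistar_operation s' \<and> s' (range to_fract) = range to_fract \<and>
           (\<forall>E\<in>fractional_ideals. s E = s' E))"

definition finite_character :: "('d::idom fract set \<Rightarrow> 'd fract set) \<Rightarrow> bool" where
  "finite_character s \<longleftrightarrow>
     (\<forall>E\<in>fractional_ideals. s E = \<Union> {s F | F. F \<in> fg_submodules \<and> F \<subseteq> E})"

definition prime_ideal :: "'d::idom set \<Rightarrow> bool" where
  "prime_ideal P \<longleftrightarrow> module.subspace (*) P \<and> P \<noteq> UNIV \<and>
     (\<forall>a b. a * b \<in> P \<longrightarrow> a \<in> P \<or> b \<in> P)"

definition star_ideal :: "('d::idom fract set \<Rightarrow> 'd fract set) \<Rightarrow> 'd set \<Rightarrow> bool" where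
  "star_ideal s I \<longleftrightarrow> module.subspace (*) I \<and> I \<noteq> {0} \<and> to_fract ` I = s (to_fract ` I)"

definition star_prime :: "('d::idom fract set \<Rightarrow> 'd fract set) \<Rightarrow> 'd set \<Rightarrow> bool" where
  "star_prime s P \<longleftrightarrow> prime_ideal P \<and> star_ideal s P"

definition star_maximal :: "('d::idom fract set \<Rightarrow> 'd fract set) \<Rightarrow> 'd set \<Rightarrow> bool" where
  "star_maximal s P \<longleftrightarrow> star_prime s P \<and> (\<forall>Q. star_prime s Q \<and> P \<subseteq> Q \<longrightarrow> Q = P)"

definition star_Max :: "('d::idom fract set \<Rightarrow> 'd fract set) \<Rightarrow> 'd set set" where
  "star_Max s = {P. star_maximal s P}"

definition colon :: "'d::idom fract set \<Rightarrow> 'd fract set" where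
  "colon E = {x. (*) x ` E \<subseteq> range to_fract}"

definition v_op :: "'d::idom fract set \<Rightarrow> 'd fract set" where
  "v_op E = colon (colon E)"

definition t_op :: "'d::idom fract set \<Rightarrow> 'd fract set" where
  "t_op E = \<Union> {v_op F | F. F \<in> fg_submodules \<and> F \<subseteq> E}"

text \<open>The set \<open>{g. fract_poly g \<in> range ((*) f)}\<close> is \<open>f K[X] \<inter> R[X]\<close>.\<close>

definition upper_to_zero :: "'r::idom poly set \<Rightarrow> bool" where
  "upper_to_zero Q \<longleftrightarrow> prime_ideal Q \<and>
     (\<exists>f :: 'r fract poly. irreducible f \<and> Q = {g. fract_poly g \<in> range ((*) f)})"

definition UMT_domain :: "'r::idom itself \<Rightarrow> bool" where
  "UMT_domain R \<longleftrightarrow> (\<forall>Q :: 'r poly set. upper_to_zero Q \<longrightarrow> star_maximal t_op Q)"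

end

theory Submission
  imports Defs
begin

text \<open>
  Write \<open>*\<close> for the star operation. Since \<open>*\<close> fixes \<open>R[X]\<close> and commutes with multiplication
  by elements, \<open>F\<^sup>* \<subseteq> F\<^sub>v\<close> for finitely generated \<open>F\<close>, so finite character gives
  \<open>I\<^sup>* \<subseteq> I\<^sub>t\<close>: every \<open>t\<close>-ideal is a \<open>*\<close>-ideal (\<open>star_ideal_if_t_ideal\<close>). By Zorn's lemma every
  proper \<open>*\<close>-ideal lies in a \<open>*\<close>-maximal ideal (\<open>exists_star_maximal\<close>). Hence the two
  maximal spectra agree as soon as every \<open>*\<close>-maximal ideal is a \<open>t\<close>-ideal, and then (i) makes every
  upper to zero \<open>t\<close>-maximal, which is the UMT property. The implication from (ii) to (i) is
  immediate.

  So let every upper to zero be \<open>*\<close>-maximal and let \<open>M\<close> be \<open>*\<close>-maximal.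

  If \<open>M\<^sub>t\<close> is proper, then it is a \<open>*\<close>-ideal contained in some \<open>*\<close>-maximal ideal, and
  maximality of \<open>M\<close> forces \<open>M = M\<^sub>t\<close>.

  If \<open>M\<^sub>t = R[X]\<close>, then \<open>1 \<in> T\<^sub>v\<close> for a finite \<open>T \<subseteq> M\<close>. Shifting the elements of \<open>T\<close> by
  sufficiently separated powers of \<open>X\<close> and adding them gives \<open>g \<in> M\<close> that has all coefficients of
  all elements of \<open>T\<close> among its own; its content \<open>c(g)\<close> then satisfies \<open>c(g)\<^sub>v = R\<close>. For such
  a \<open>g\<close> Gauss's lemma holds in the form \<open>g K[X] \<inter> R[X] = g R[X]\<close>
  (\<open>contraction_superprimitive\<close>), so \<open>g K[X] \<inter> R[X] \<subseteq> M\<close>. Splitting \<open>g\<close> over \<open>K\<close> and using that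
  \<open>M\<close> is prime, some irreducible factor \<open>f\<close> of \<open>g\<close> has \<open>f K[X] \<inter> R[X] \<subseteq> M\<close>. This upper to
  zero is \<open>*\<close>-maximal, hence equal to \<open>M\<close>; and uppers to zero are always \<open>t\<close>-ideals
  (\<open>t_ideal_contraction\<close>).
\<close>

interpretation fract: module "fract_scale :: 'd::idom \<Rightarrow> 'd fract \<Rightarrow> 'd fract"
  by (rule module_fract)

interpretation self: module "(*) :: 'd::idom \<Rightarrow> 'd \<Rightarrow> 'd"
  by (rule module_self)


section \<open>Divisorial closure and the \<open>t\<close>-operation\<close>

lemma mem_colon_iff: "x \<in> colon E \<longleftrightarrow> (\<forall>y\<in>E. x * y \<in> range to_fract)"
  by (auto simp: colon_def)

lemma range_to_fract_add: "x \<in> range to_fract \<Longrightarrow> y \<in> range to_fract \<Longrightarrow> x + y \<in> range to_fract"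
  by (auto simp flip: to_fract_add)

lemma range_to_fract_scale: "x \<in> range to_fract \<Longrightarrow> to_fract d * x \<in> range to_fract"
  by (auto simp flip: to_fract_mult)

lemma zero_in_range_to_fract: "0 \<in> range to_fract"
  by (rule range_eqI[of _ _ 0]) simp

lemma subspace_range_to_fract: "fract.subspace (range to_fract)"
  by (rule fract.subspaceI)
    (rule zero_in_range_to_fract range_to_fract_add range_to_fract_scale; assumption?)+

lemma range_to_fract_in_nonzero_submodules: "range to_fract \<in> nonzero_submodules"
proof -
  have "to_fract 1 \<in> range to_fract - {0}"
    using rangeI[of to_fract 1] by simp
  then show ?thesis
    using subspace_range_to_fract unfolding nonzero_submodules_def by blast
qed

lemma subspace_colon: "fract.subspace (colon E)"
proof (rule fract.subspaceI)
  show "0 \<in> colon E"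
    using zero_in_range_to_fract by (simp add: mem_colon_iff)
  show "x + y \<in> colon E" if "x \<in> colon E" "y \<in> colon E" for x y
    using that range_to_fract_add unfolding mem_colon_iff distrib_right by blast
  show "fract_scale d x \<in> colon E" if "x \<in> colon E" for d x
    using that range_to_fract_scale unfolding mem_colon_iff mult.assoc by blast
qed

lemma colon_antimono: "E \<subseteq> F \<Longrightarrow> colon F \<subseteq> colon E"
  unfolding colon_def by blast

lemma colon_span: "colon (fract.span S) = colon S"
proof
  show "colon (fract.span S) \<subseteq> colon S"
    by (rule colon_antimono) (rule fract.span_superset)
  show "colon S \<subseteq> colon (fract.span S)"
  proof
    fix x assume x: "x \<in> colon S"
    have sub: "fract.subspace {y. x * y \<in> range to_fract}"
    proof (rule fract.subspaceI)
      show "fract_scale d y \<in> {y. x * y \<in> range to_fract}" if "y \<in> {y. x * y \<in> range to_fract}" for d y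
        using that range_to_fract_scale[of "x * y" d] by (simp only: mem_Collect_eq mult.left_commute)
    qed (simp_all only: mem_Collect_eq mult_zero_right distrib_left zero_in_range_to_fract range_to_fract_add)
    have "fract.span S \<subseteq> {y. x * y \<in> range to_fract}"
      by (rule fract.span_minimal) (use x sub in \<open>auto simp: mem_colon_iff\<close>)
    then show "x \<in> colon (fract.span S)"
      by (auto simp: mem_colon_iff)
  qed
qed

lemma colon_scale:
  assumes a: "a \<noteq> 0"
  shows "colon ((*) a ` E) = (*) (inverse a) ` colon E"
proof -
  have iff: "x \<in> colon ((*) a ` E) \<longleftrightarrow> a * x \<in> colon E" for x
    by (simp only: mem_colon_iff ball_simps mult.assoc mult.left_commute[of x a])
  have inv: "inverse a * (a * x) = x" "a * (inverse a * x) = x" for x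
    using a by (simp_all add: mult.assoc[symmetric])
  show ?thesis
  proof (intro equalityI subsetI)
    fix x assume "x \<in> colon ((*) a ` E)"
    then have "inverse a * (a * x) \<in> (*) (inverse a) ` colon E"
      unfolding iff by (rule imageI)
    then show "x \<in> (*) (inverse a) ` colon E"
      unfolding inv .
  next
    fix x assume "x \<in> (*) (inverse a) ` colon E"
    then obtain z where "x = inverse a * z" "z \<in> colon E"
      by (rule imageE)
    then show "x \<in> colon ((*) a ` E)"
      by (simp only: iff inv)
  qed
qed

lemma subspace_v_op: "fract.subspace (v_op E)"
  unfolding v_op_def by (rule subspace_colon)

lemma subset_v_op: "E \<subseteq> v_op E"
proof
  fix x assume x: "x \<in> E"
  have "x * y \<in> range to_fract" if "y \<in> colon E" for y
    using that x unfolding mem_colon_iff[of y] by (subst mult.commute) blast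
  then show "x \<in> v_op E"
    unfolding v_op_def mem_colon_iff[of x] by blast
qed

lemma v_op_mono: "E \<subseteq> F \<Longrightarrow> v_op E \<subseteq> v_op F"
  unfolding v_op_def by (intro colon_antimono)

text \<open>Taking colons is an antitone Galois connection from sets to sets, and \<open>v_op\<close> is the closure
  operator that it induces.\<close>

lemma v_op_idem: "v_op (v_op E) = v_op E"
  unfolding v_op_def
  using colon_antimono[OF subset_v_op[of E]] subset_v_op[of "colon E"]
  by (simp add: v_op_def subset_antisym)

lemma v_op_span: "v_op (fract.span S) = v_op S"
  by (simp add: v_op_def colon_span)

lemma v_op_scale: "a \<noteq> 0 \<Longrightarrow> v_op ((*) a ` E) = (*) a ` v_op E"
  by (simp add: v_op_def colon_scale)

lemma v_op_subset_range:
  assumes "E \<subseteq> range to_fract"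
  shows "v_op E \<subseteq> range to_fract"
proof
  fix x assume "x \<in> v_op E"
  moreover have "1 \<in> colon E"
    using assms by (auto simp: mem_colon_iff)
  ultimately show "x \<in> range to_fract"
    unfolding v_op_def by (metis mem_colon_iff mult.right_neutral)
qed

lemma span_in_fg_submodules:
  assumes "finite T" "t \<in> T" "t \<noteq> 0"
  shows "fract.span T \<in> fg_submodules"
  using assms fract.span_base[of t T] unfolding fg_submodules_def nonzero_submodules_def by auto

text \<open>Witnesses that are finite subsets, rather than finitely generated submodules, are joined by
  taking unions. A witness all of whose elements vanish is turned into a nonzero submodule
  by adding a nonzero element of \<open>E\<close>.\<close>

lemma mem_t_op_iff:
  assumes "E \<in> nonzero_submodules"
  shows "x \<in> t_op E \<longleftrightarrow> (\<exists>T. finite T \<and> T \<subseteq> E \<and> x \<in> v_op T)"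
proof
  assume "x \<in> t_op E"
  then obtain F where F: "F \<in> fg_submodules" "F \<subseteq> E" "x \<in> v_op F"
    unfolding t_op_def by blast
  from F(1) obtain T where T: "finite T" "F = fract.span T"
    unfolding fg_submodules_def by blast
  have "T \<subseteq> E"
    using F(2) T(2) fract.span_superset[of T] by blast
  with F(3) T show "\<exists>T. finite T \<and> T \<subseteq> E \<and> x \<in> v_op T"
    by (auto simp: v_op_span)
next
  assume "\<exists>T. finite T \<and> T \<subseteq> E \<and> x \<in> v_op T"
  then obtain T where T: "finite T" "T \<subseteq> E" "x \<in> v_op T"
    by blast
  have E: "fract.subspace E" "E \<noteq> {0}"
    using assms by (auto simp: nonzero_submodules_def)
  then obtain e where e: "e \<in> E" "e \<noteq> 0"
    using fract.subspace_0 by blast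
  let ?F = "fract.span (insert e T)"
  have "?F \<in> fg_submodules"
    by (rule span_in_fg_submodules) (use T e in auto)
  moreover have "?F \<subseteq> E"
    by (rule fract.span_minimal) (use T e E in auto)
  moreover have "x \<in> v_op ?F"
    using T(3) v_op_mono[of T "insert e T"] by (auto simp: v_op_span)
  ultimately show "x \<in> t_op E"
    unfolding t_op_def by blast
qed

lemma t_op_mono: "E \<subseteq> F \<Longrightarrow> t_op E \<subseteq> t_op F"
  unfolding t_op_def by blast

lemma subset_t_op:
  assumes "E \<in> nonzero_submodules"
  shows "E \<subseteq> t_op E"
proof
  fix x assume "x \<in> E"
  then have "finite {x} \<and> {x} \<subseteq> E \<and> x \<in> v_op {x}"
    using subset_v_op[of "{x}"] by simp
  then show "x \<in> t_op E"
    unfolding mem_t_op_iff[OF assms] by blast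
qed

lemma t_op_in_nonzero_submodules:
  assumes E: "E \<in> nonzero_submodules"
  shows "t_op E \<in> nonzero_submodules"
proof -
  have "fract.subspace (t_op E)"
  proof (rule fract.subspaceI)
    show "0 \<in> t_op E"
      using subset_t_op[OF E] E by (auto simp: nonzero_submodules_def dest: fract.subspace_0)
  next
    fix x y assume "x \<in> t_op E" "y \<in> t_op E"
    then obtain S T where "finite S" "S \<subseteq> E" "x \<in> v_op S" "finite T" "T \<subseteq> E" "y \<in> v_op T"
      unfolding mem_t_op_iff[OF E] by blast
    moreover from this have "x \<in> v_op (S \<union> T)" "y \<in> v_op (S \<union> T)"
      using v_op_mono[of S "S \<union> T"] v_op_mono[of T "S \<union> T"] by auto
    ultimately have "finite (S \<union> T) \<and> S \<union> T \<subseteq> E \<and> x + y \<in> v_op (S \<union> T)"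
      using fract.subspace_add[OF subspace_v_op] by auto
    then show "x + y \<in> t_op E"
      unfolding mem_t_op_iff[OF E] by blast
  next
    fix d x assume "x \<in> t_op E"
    then show "fract_scale d x \<in> t_op E"
      unfolding mem_t_op_iff[OF E] using fract.subspace_scale[OF subspace_v_op] by blast
  qed
  moreover have "t_op E \<noteq> {0}"
    using subset_t_op[OF E] E unfolding nonzero_submodules_def by (auto dest: fract.subspace_0)
  ultimately show ?thesis
    by (simp add: nonzero_submodules_def)
qed

text \<open>The sets \<open>v_op T\<close>, for finite \<open>T \<subseteq> E\<close>, are directed by inclusion; this is what makes \<open>t\<close>
  idempotent.\<close>

lemma finite_subset_t_op:
  assumes E: "E \<in> nonzero_submodules" and "finite S" "S \<subseteq> t_op E"
  shows "\<exists>T. finite T \<and> T \<subseteq> E \<and> S \<subseteq> v_op T"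
  using assms(2,3)
proof (induction S rule: finite_induct)
  case empty
  then show ?case by blast
next
  case (insert x S)
  have "S \<subseteq> t_op E" "x \<in> t_op E"
    using insert.prems by simp_all
  obtain T where T: "finite T" "T \<subseteq> E" "S \<subseteq> v_op T"
    using insert.IH[OF \<open>S \<subseteq> t_op E\<close>] by (elim exE conjE)
  obtain T' where T': "finite T'" "T' \<subseteq> E" "x \<in> v_op T'"
    using \<open>x \<in> t_op E\<close> unfolding mem_t_op_iff[OF E] by (elim exE conjE)
  have "insert x S \<subseteq> v_op (T \<union> T')"
    using T(3) T'(3) v_op_mono[of T "T \<union> T'"] v_op_mono[of T' "T \<union> T'"] by blast
  moreover have "finite (T \<union> T')" "T \<union> T' \<subseteq> E"
    using T T' by simp_all
  ultimately show ?case
    by (intro exI[of _ "T \<union> T'"] conjI)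
qed

lemma t_op_idem:
  assumes E: "E \<in> nonzero_submodules"
  shows "t_op (t_op E) = t_op E"
proof
  show "t_op E \<subseteq> t_op (t_op E)"
    by (intro subset_t_op t_op_in_nonzero_submodules E)
  show "t_op (t_op E) \<subseteq> t_op E"
  proof
    fix x assume "x \<in> t_op (t_op E)"
    then obtain S where S: "finite S" "S \<subseteq> t_op E" "x \<in> v_op S"
      unfolding mem_t_op_iff[OF t_op_in_nonzero_submodules[OF E]] by (elim exE conjE)
    obtain T where T: "finite T" "T \<subseteq> E" "S \<subseteq> v_op T"
      using finite_subset_t_op[OF E S(1,2)] by (elim exE conjE)
    have "x \<in> v_op T"
      using v_op_mono[OF T(3)] S(3) unfolding v_op_idem by (rule subsetD)
    with T show "x \<in> t_op E"
      unfolding mem_t_op_iff[OF E] by (intro exI conjI)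
  qed
qed

lemma scale_in_nonzero_submodules:
  assumes "E \<in> nonzero_submodules" "a \<noteq> 0"
  shows "(*) a ` E \<in> nonzero_submodules"
proof -
  have E: "fract.subspace E" "E \<noteq> {0}"
    using assms by (auto simp: nonzero_submodules_def)
  have "fract.subspace ((*) a ` E)"
  proof (rule fract.subspaceI)
    show "0 \<in> (*) a ` E"
      by (rule image_eqI[of _ _ 0]) (simp_all add: fract.subspace_0[OF E(1)])
  next
    fix x y assume "x \<in> (*) a ` E" "y \<in> (*) a ` E"
    then obtain u v where uv: "u \<in> E" "v \<in> E" and eq: "x = a * u" "y = a * v"
      by blast
    have "a * (u + v) \<in> (*) a ` E"
      using fract.subspace_add[OF E(1) uv] by (rule imageI)
    then show "x + y \<in> (*) a ` E"
      unfolding eq distrib_left .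
  next
    fix d x assume "x \<in> (*) a ` E"
    then obtain u where u: "u \<in> E" and eq: "x = a * u"
      by blast
    have "a * (to_fract d * u) \<in> (*) a ` E"
      using fract.subspace_scale[OF E(1) u] by (rule imageI)
    then show "fract_scale d x \<in> (*) a ` E"
      unfolding eq mult.left_commute[of a] .
  qed
  moreover have "(*) a ` E \<noteq> {0}"
  proof -
    obtain e where "e \<in> E" "e \<noteq> 0"
      using E(2) fract.subspace_0[OF E(1)] by blast
    then have "a * e \<in> (*) a ` E" "a * e \<noteq> 0"
      using assms(2) by simp_all
    then show ?thesis
      by blast
  qed
  ultimately show ?thesis
    by (simp add: nonzero_submodules_def)
qed

lemma t_op_scale_subset:
  assumes E: "E \<in> nonzero_submodules" and a: "a \<noteq> 0"
  shows "(*) a ` t_op E \<subseteq> t_op ((*) a ` E)"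
proof
  fix y assume "y \<in> (*) a ` t_op E"
  then obtain x where x: "x \<in> t_op E" "y = a * x"
    by blast
  from x(1) obtain T where T: "finite T" "T \<subseteq> E" "x \<in> v_op T"
    unfolding mem_t_op_iff[OF E] by (elim exE conjE)
  have "y \<in> v_op ((*) a ` T)"
    unfolding v_op_scale[OF a] x(2) using T(3) by (rule imageI)
  moreover have "finite ((*) a ` T)" "(*) a ` T \<subseteq> (*) a ` E"
    using T(1,2) by (simp_all add: image_mono)
  ultimately show "y \<in> t_op ((*) a ` E)"
    unfolding mem_t_op_iff[OF scale_in_nonzero_submodules[OF E a]] by (intro exI conjI)
qed

lemma t_op_scale:
  assumes E: "E \<in> nonzero_submodules" and a: "a \<noteq> 0"
  shows "t_op ((*) a ` E) = (*) a ` t_op E"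
proof
  show "(*) a ` t_op E \<subseteq> t_op ((*) a ` E)"
    by (rule t_op_scale_subset[OF E a])
  have inv: "(*) (inverse a) ` (*) a ` A = A" "(*) a ` (*) (inverse a) ` A = A" for A
    unfolding image_image mult.assoc[symmetric] using a by simp_all
  have "(*) (inverse a) ` t_op ((*) a ` E) \<subseteq> t_op ((*) (inverse a) ` (*) a ` E)"
    by (rule t_op_scale_subset) (use a in \<open>simp_all add: scale_in_nonzero_submodules[OF E]\<close>)
  then have "(*) a ` (*) (inverse a) ` t_op ((*) a ` E) \<subseteq> (*) a ` t_op E"
    unfolding inv(1) by (rule image_mono)
  then show "t_op ((*) a ` E) \<subseteq> (*) a ` t_op E"
    unfolding inv(2) .
qed

lemma semistar_operation_t_op: "semistar_operation t_op"
  unfolding semistar_operation_def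
  by (intro conjI ballI allI impI t_op_in_nonzero_submodules t_op_scale subset_t_op t_op_mono t_op_idem)

lemma star_operation_t_op: "star_operation t_op"
proof -
  have "t_op (range to_fract) = range to_fract"
  proof
    show "t_op (range to_fract) \<subseteq> range to_fract"
      using v_op_subset_range unfolding t_op_def by blast
  qed (rule subset_t_op[OF range_to_fract_in_nonzero_submodules])
  then show ?thesis
    unfolding star_operation_def
    by (intro exI[of _ t_op] conjI ballI refl semistar_operation_t_op)
qed

lemma t_op_fg:
  assumes "F \<in> fg_submodules"
  shows "t_op F = v_op F"
proof
  show "t_op F \<subseteq> v_op F"
  proof
    fix x assume "x \<in> t_op F"
    then obtain G where "x \<in> v_op G" "G \<subseteq> F"
      unfolding t_op_def by blast
    then show "x \<in> v_op F"
      using v_op_mono[of G F] by blast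
  qed
  show "v_op F \<subseteq> t_op F"
    unfolding t_op_def using assms by blast
qed

lemma finite_character_t_op: "finite_character t_op"
  unfolding finite_character_def
proof
  fix E :: "'a fract set"
  have "{t_op F | F. F \<in> fg_submodules \<and> F \<subseteq> E} = {v_op F | F. F \<in> fg_submodules \<and> F \<subseteq> E}"
    by (intro Collect_cong ex_cong1) (metis t_op_fg)
  then show "t_op E = \<Union> {t_op F | F. F \<in> fg_submodules \<and> F \<subseteq> E}"
    by (simp only: t_op_def)
qed


section \<open>Star operations of finite character on integral ideals\<close>

definition nonzero_ideal :: "'d::idom set \<Rightarrow> bool" where
  "nonzero_ideal I \<longleftrightarrow> self.subspace I \<and> I \<noteq> {0}"

text \<open>Prime ideals live in \<open>D\<close> while star operations act on submodules of its quotient field.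
  Pulling the operation back to \<open>D\<close> gives a closure operator on nonzero ideals which is compatible
  with multiplication by elements, and which is algebraic when the character is finite.\<close>

definition ideal_closure :: "('d::idom fract set \<Rightarrow> 'd fract set) \<Rightarrow> 'd set \<Rightarrow> 'd set" where
  "ideal_closure s I = to_fract -` s (to_fract ` I)"

lemma to_fract_image_eq_iff [simp]: "to_fract ` I = to_fract ` J \<longleftrightarrow> I = J"
  by (rule inj_image_eq_iff) (auto intro: injI)

lemma subspace_to_fract_image_iff: "fract.subspace (to_fract ` I) \<longleftrightarrow> self.subspace I"
proof
  assume I: "fract.subspace (to_fract ` I)"
  show "self.subspace I"
  proof (rule self.subspaceI)
    show "0 \<in> I"
      using fract.subspace_0[OF I] by auto
    show "x + y \<in> I" if "x \<in> I" "y \<in> I" for x y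
      using that fract.subspace_add[OF I, of "to_fract x" "to_fract y"]
      by (auto simp flip: to_fract_add)
    show "d * x \<in> I" if "x \<in> I" for d x
      using that fract.subspace_scale[OF I, of "to_fract x" d] by (auto simp flip: to_fract_mult)
  qed
next
  assume I: "self.subspace I"
  show "fract.subspace (to_fract ` I)"
  proof (rule fract.subspaceI)
    show "0 \<in> to_fract ` I"
      using self.subspace_0[OF I] by (metis image_eqI to_fract_0)
    show "x + y \<in> to_fract ` I" if "x \<in> to_fract ` I" "y \<in> to_fract ` I" for x y
      using that self.subspace_add[OF I] by (auto simp flip: to_fract_add)
    show "fract_scale d x \<in> to_fract ` I" if "x \<in> to_fract ` I" for d x
      using that self.subspace_scale[OF I] by (auto simp flip: to_fract_mult)
  qed
qed

lemma to_fract_image_in_nonzero_submodules_iff: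
  "to_fract ` I \<in> nonzero_submodules \<longleftrightarrow> nonzero_ideal I"
  using to_fract_image_eq_iff[of I "{0}"]
  by (simp add: nonzero_submodules_def nonzero_ideal_def subspace_to_fract_image_iff)

lemma fractional_idealI:
  assumes "E \<in> nonzero_submodules" "E \<subseteq> range to_fract"
  shows "E \<in> fractional_ideals"
  using assms unfolding fractional_ideals_def by (auto intro!: exI[of _ 1])

locale finite_star =
  fixes s :: "'d::idom fract set \<Rightarrow> 'd fract set"
  assumes star: "star_operation s" and fin_char: "finite_character s"
begin

text \<open>A star operation agrees with some semistar operation on fractional ideals. Restricting to
  submodules of \<open>D\<close>, all of which are fractional ideals, transfers the axioms without mention of
  that extension.\<close>

lemma integral_submodule:
  assumes "E \<in> nonzero_submodules" "E \<subseteq> range to_fract"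
  shows "s E \<in> nonzero_submodules" "s E \<subseteq> range to_fract" "E \<subseteq> s E" "s (s E) = s E"
    "\<And>F. F \<in> nonzero_submodules \<Longrightarrow> F \<subseteq> range to_fract \<Longrightarrow> E \<subseteq> F \<Longrightarrow> s E \<subseteq> s F"
    "\<And>a. a \<noteq> 0 \<Longrightarrow> (*) a ` E \<subseteq> range to_fract \<Longrightarrow> s ((*) a ` E) = (*) a ` s E"
proof -
  obtain s' where s': "semistar_operation s'" "s' (range to_fract) = range to_fract"
      and eq: "\<And>E. E \<in> fractional_ideals \<Longrightarrow> s E = s' E"
    using star unfolding star_operation_def by blast
  have eq': "s E = s' E" if "E \<in> nonzero_submodules" "E \<subseteq> range to_fract" for E
    using that by (intro eq fractional_idealI)
  show 1: "s E \<in> nonzero_submodules" and "E \<subseteq> s E"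
    using assms s'(1) by (auto simp: eq' semistar_operation_def)
  have "s' E \<subseteq> s' (range to_fract)"
    using assms s'(1) range_to_fract_in_nonzero_submodules
    unfolding semistar_operation_def by blast
  then show 2: "s E \<subseteq> range to_fract"
    using assms by (simp add: eq' s'(2))
  show "s (s E) = s E"
    using eq'[OF 1 2] assms s'(1) by (simp add: eq' semistar_operation_def)
  show "s E \<subseteq> s F" if "F \<in> nonzero_submodules" "F \<subseteq> range to_fract" "E \<subseteq> F" for F
    using assms that s'(1) by (simp add: eq' semistar_operation_def)
  show "s ((*) a ` E) = (*) a ` s E" if "a \<noteq> 0" "(*) a ` E \<subseteq> range to_fract" for a
    using assms that s'(1) scale_in_nonzero_submodules[OF assms(1), of a]
    by (simp add: eq' semistar_operation_def)
qed

text \<open>If \<open>yE \<subseteq> D\<close>, then \<open>yE\<^sup>* = (yE)\<^sup>* \<subseteq> D\<^sup>* = D\<close>: the divisorial closure is the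
  largest star operation.\<close>

lemma subset_v_op_of_integral:
  assumes E: "E \<in> nonzero_submodules" "E \<subseteq> range to_fract"
  shows "s E \<subseteq> v_op E"
proof
  obtain s' where s': "semistar_operation s'" "s' (range to_fract) = range to_fract"
      and eq: "\<And>E. E \<in> fractional_ideals \<Longrightarrow> s E = s' E"
    using star unfolding star_operation_def by blast
  fix x assume "x \<in> s E"
  then have x: "x \<in> s' E"
    using eq[OF fractional_idealI[OF E]] by simp
  have "x * y \<in> range to_fract" if y: "y \<in> colon E" for y
  proof (cases "y = 0")
    case True
    then show ?thesis
      using zero_in_range_to_fract by simp
  next
    case False
    have "y * x \<in> (*) y ` s' E"
      using x by (rule imageI)
    also have "\<dots> = s' ((*) y ` E)"
      using s'(1) E(1) False unfolding semistar_operation_def by simp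
    also have "\<dots> \<subseteq> s' (range to_fract)"
      using s'(1) scale_in_nonzero_submodules[OF E(1) False] y
        range_to_fract_in_nonzero_submodules
      unfolding semistar_operation_def colon_def by blast
    finally show ?thesis
      by (simp add: s'(2) mult.commute)
  qed
  then show "x \<in> v_op E"
    by (simp add: v_op_def mem_colon_iff[of x])
qed

lemma to_fract_image_ideal_closure:
  assumes "nonzero_ideal I"
  shows "to_fract ` ideal_closure s I = s (to_fract ` I)"
  using integral_submodule(2)[of "to_fract ` I"] assms
  by (auto simp: ideal_closure_def to_fract_image_in_nonzero_submodules_iff)

lemma star_ideal_iff: "star_ideal s I \<longleftrightarrow> nonzero_ideal I \<and> ideal_closure s I = I"
proof (cases "nonzero_ideal I")
  case True
  then have "to_fract ` I = s (to_fract ` I) \<longleftrightarrow> ideal_closure s I = I"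
    by (metis to_fract_image_ideal_closure to_fract_image_eq_iff)
  with True show ?thesis
    unfolding star_ideal_def nonzero_ideal_def by blast
next
  case False
  then show ?thesis
    unfolding star_ideal_def nonzero_ideal_def by blast
qed

lemma nonzero_ideal_ideal_closure:
  assumes "nonzero_ideal I"
  shows "nonzero_ideal (ideal_closure s I)"
  using integral_submodule(1)[of "to_fract ` I"] assms
  by (auto simp: to_fract_image_ideal_closure simp flip: to_fract_image_in_nonzero_submodules_iff)

lemma subset_ideal_closure:
  assumes "nonzero_ideal I"
  shows "I \<subseteq> ideal_closure s I"
  using integral_submodule(3)[of "to_fract ` I"] assms
  by (auto simp: ideal_closure_def to_fract_image_in_nonzero_submodules_iff)

lemma ideal_closure_mono:
  assumes "nonzero_ideal I" "nonzero_ideal J" "I \<subseteq> J"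
  shows "ideal_closure s I \<subseteq> ideal_closure s J"
  using integral_submodule(5)[of "to_fract ` I" "to_fract ` J"] assms
  by (auto simp: ideal_closure_def to_fract_image_in_nonzero_submodules_iff image_mono)

lemma star_ideal_ideal_closure:
  assumes "nonzero_ideal I"
  shows "star_ideal s (ideal_closure s I)"
  using integral_submodule(4)[of "to_fract ` I"] assms nonzero_ideal_ideal_closure[OF assms]
  by (auto simp: star_ideal_def nonzero_ideal_def to_fract_image_ideal_closure
      to_fract_image_in_nonzero_submodules_iff)

text \<open>This is how the axiom \<open>(aE)\<^sup>* = aE\<^sup>*\<close> enters the proof that maximal proper \<open>*\<close>-ideals
  are prime: an element that multiplies \<open>I\<close> into \<open>J\<close> multiplies the closure of \<open>I\<close> into that of
  \<open>J\<close>.\<close>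

lemma ideal_closure_mult:
  assumes I: "nonzero_ideal I" and J: "nonzero_ideal J" and "\<And>x. x \<in> I \<Longrightarrow> b * x \<in> J"
    and x: "x \<in> ideal_closure s I"
  shows "b * x \<in> ideal_closure s J"
proof (cases "b = 0")
  case True
  then show ?thesis
    using nonzero_ideal_ideal_closure[OF J] by (auto simp: nonzero_ideal_def dest: self.subspace_0)
next
  case False
  define E where "E = to_fract ` I"
  have E: "E \<in> nonzero_submodules" "E \<subseteq> range to_fract"
    using I by (auto simp: E_def to_fract_image_in_nonzero_submodules_iff)
  have bE: "(*) (to_fract b) ` E \<in> nonzero_submodules" "(*) (to_fract b) ` E \<subseteq> to_fract ` J"
    using assms(3) scale_in_nonzero_submodules[OF E(1)] False
    by (auto simp: E_def simp flip: to_fract_mult)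
  have J': "to_fract ` J \<in> nonzero_submodules" "to_fract ` J \<subseteq> range to_fract"
    using J by (auto simp: to_fract_image_in_nonzero_submodules_iff)
  have bE_range: "(*) (to_fract b) ` E \<subseteq> range to_fract"
    using bE(2) J'(2) by (rule subset_trans)
  have "to_fract b * to_fract x \<in> (*) (to_fract b) ` s E"
    using x unfolding ideal_closure_def E_def by (intro imageI) simp
  also have "\<dots> = s ((*) (to_fract b) ` E)"
    using integral_submodule(6)[OF E _ bE_range] False by simp
  also have "\<dots> \<subseteq> s (to_fract ` J)"
    by (rule integral_submodule(5)[OF bE(1) bE_range J' bE(2)])
  finally show ?thesis
    by (simp add: ideal_closure_def)
qed

text \<open>Membership in the closure of \<open>self.span T\<close> serves the passage to unions of chains, and
  membership in \<open>v_op (to_fract ` T)\<close> compares \<open>*\<close> with \<open>t\<close>.\<close>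

lemma ideal_closure_finite:
  assumes I: "nonzero_ideal I" and x: "x \<in> ideal_closure s I"
  obtains T where "finite T" "T \<subseteq> I" "nonzero_ideal (self.span T)"
    "x \<in> ideal_closure s (self.span T)" "to_fract x \<in> v_op (to_fract ` T)"
proof -
  have "to_fract ` I \<in> fractional_ideals"
    using I by (auto intro: fractional_idealI simp: to_fract_image_in_nonzero_submodules_iff)
  then obtain F where F: "F \<in> fg_submodules" "F \<subseteq> to_fract ` I" "to_fract x \<in> s F"
    using x fin_char unfolding finite_character_def ideal_closure_def by blast
  obtain S where S: "finite S" "F = fract.span S"
    using F(1) unfolding fg_submodules_def by blast
  have "S \<subseteq> to_fract ` I"
    using F(2) S(2) fract.span_superset[of S] by blast
  then obtain T where T: "T \<subseteq> I" "S = to_fract ` T" "finite T"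
    using S(1) by (metis finite_subset_image)
  interpret hom: module_hom "(*) :: 'd \<Rightarrow> 'd \<Rightarrow> 'd" fract_scale to_fract
    by (intro_locales; unfold_locales) auto
  have F_eq: "F = to_fract ` self.span T"
    using S(2) T(2) by (simp add: hom.span_image)
  have F': "F \<in> nonzero_submodules"
    using F(1) by (simp add: fg_submodules_def)
  show thesis
  proof
    show "nonzero_ideal (self.span T)"
      using F' by (simp add: F_eq to_fract_image_in_nonzero_submodules_iff)
    show "x \<in> ideal_closure s (self.span T)"
      using F(3) by (simp add: ideal_closure_def F_eq)
    have "to_fract x \<in> v_op F"
      using F(2,3) subset_v_op_of_integral[OF F'] by blast
    then show "to_fract x \<in> v_op (to_fract ` T)"
      using S(2) T(2) by (simp add: v_op_span)
  qed (use T in auto)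
qed

lemma ideal_closure_subset_t:
  assumes I: "nonzero_ideal I"
  shows "ideal_closure s I \<subseteq> ideal_closure t_op I"
proof
  fix x assume "x \<in> ideal_closure s I"
  then obtain T where T: "finite T" "T \<subseteq> I" "to_fract x \<in> v_op (to_fract ` T)"
    using ideal_closure_finite[OF I] by metis
  then have "finite (to_fract ` T)" "to_fract ` T \<subseteq> to_fract ` I"
    by auto
  with T(3) show "x \<in> ideal_closure t_op I"
    using mem_t_op_iff[of "to_fract ` I"] I
    by (auto simp: ideal_closure_def to_fract_image_in_nonzero_submodules_iff)
qed

end

interpretation t: finite_star t_op
  by unfold_locales (rule star_operation_t_op finite_character_t_op)+

context finite_star
begin

lemma star_ideal_if_t_ideal:
  assumes "star_ideal t_op I"
  shows "star_ideal s I"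
  using assms ideal_closure_subset_t[of I] subset_ideal_closure[of I]
  unfolding star_ideal_iff t.star_ideal_iff by blast

text \<open>Finite character is essential here: membership in the closure of the union is witnessed by
  finitely many elements, which already lie in one member of the chain.\<close>

lemma star_ideal_Union_chain:
  assumes ne: "C \<noteq> {}" and chain: "\<And>I J. I \<in> C \<Longrightarrow> J \<in> C \<Longrightarrow> I \<subseteq> J \<or> J \<subseteq> I"
    and C: "\<And>I. I \<in> C \<Longrightarrow> star_ideal s I"
  shows "star_ideal s (\<Union>C)"
proof -
  have sub: "self.subspace I" and ne0: "I \<noteq> {0}" if "I \<in> C" for I
    using C[OF that] by (auto simp: star_ideal_def)
  have "self.subspace (\<Union>C)"
  proof (rule self.subspaceI)
    show "0 \<in> \<Union>C"
      using ne sub self.subspace_0 by blast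
    show "x + y \<in> \<Union>C" if "x \<in> \<Union>C" "y \<in> \<Union>C" for x y
    proof -
      from that obtain I J where IJ: "I \<in> C" "J \<in> C" "x \<in> I" "y \<in> J"
        by blast
      then have "\<exists>K\<in>C. x \<in> K \<and> y \<in> K"
        using chain[of I J] by blast
      then show ?thesis
        using sub self.subspace_add by blast
    qed
    show "d * x \<in> \<Union>C" if "x \<in> \<Union>C" for d x
      using that sub self.subspace_scale by blast
  qed
  moreover have "\<Union>C \<noteq> {0}"
    using ne ne0 sub self.subspace_0 by blast
  ultimately have U: "nonzero_ideal (\<Union>C)"
    by (simp add: nonzero_ideal_def)
  have finite_in_chain: "\<exists>I\<in>C. T \<subseteq> I" if "finite T" "T \<subseteq> \<Union>C" for T
    using that
  proof (induction T rule: finite_induct)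
    case empty
    then show ?case using ne by blast
  next
    case (insert x T)
    then obtain I J where "I \<in> C" "J \<in> C" "T \<subseteq> I" "x \<in> J"
      by blast
    then show ?case
      using chain[of I J] by blast
  qed
  have "ideal_closure s (\<Union>C) \<subseteq> \<Union>C"
  proof
    fix x assume "x \<in> ideal_closure s (\<Union>C)"
    then obtain T where T: "finite T" "T \<subseteq> \<Union>C" "nonzero_ideal (self.span T)"
        "x \<in> ideal_closure s (self.span T)"
      using ideal_closure_finite[OF U] by metis
    obtain I where I: "I \<in> C" "T \<subseteq> I"
      using finite_in_chain[OF T(1,2)] by blast
    have "self.span T \<subseteq> I"
      by (rule self.span_minimal) (use I sub in auto)
    then have "x \<in> ideal_closure s I"
      using ideal_closure_mono[OF T(3), of I] T(4) C[OF I(1)] by (auto simp: star_ideal_iff)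
    then show "x \<in> \<Union>C"
      using C[OF I(1)] I(1) by (auto simp: star_ideal_iff)
  qed
  then show ?thesis
    using U subset_ideal_closure[OF U] by (auto simp: star_ideal_iff)
qed

text \<open>Let \<open>ab \<in> P\<close> with \<open>a \<notin> P\<close>. By maximality \<open>1 \<in> (P + aD)\<^sup>*\<close>, and \<open>b\<close> multiplies
  \<open>P + aD\<close> into \<open>P\<close>, whence \<open>b = b \<cdot> 1 \<in> P\<^sup>* = P\<close>.\<close>

lemma prime_if_maximal_proper_star_ideal:
  assumes P: "star_ideal s P" "P \<noteq> UNIV"
    and max: "\<And>I. star_ideal s I \<Longrightarrow> I \<noteq> UNIV \<Longrightarrow> P \<subseteq> I \<Longrightarrow> I = P"
  shows "prime_ideal P"
proof -
  have P': "nonzero_ideal P" "ideal_closure s P = P" "self.subspace P"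
    using P(1) by (auto simp: star_ideal_iff nonzero_ideal_def)
  have "b \<in> P" if ab: "a * b \<in> P" and a: "a \<notin> P" for a b
  proof -
    let ?I = "self.span (insert a P)"
    have PI: "P \<subseteq> ?I" "a \<in> ?I"
      using self.span_superset[of "insert a P"] by auto
    then have I: "nonzero_ideal ?I"
      using P'(1) self.subspace_0[OF P'(3)] by (auto simp: nonzero_ideal_def)
    have "ideal_closure s ?I \<noteq> P"
      using subset_ideal_closure[OF I] PI a by blast
    then have "ideal_closure s ?I = UNIV"
      using max[OF star_ideal_ideal_closure[OF I]] subset_ideal_closure[OF I] PI by blast
    moreover have "b * x \<in> P" if "x \<in> ?I" for x
    proof -
      have sub: "self.subspace {x. b * x \<in> P}"
      proof (rule self.subspaceI)
        show "d * x \<in> {x. b * x \<in> P}" if "x \<in> {x. b * x \<in> P}" for d x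
          using that self.subspace_scale[OF P'(3), of "b * x" d] by (simp only: mem_Collect_eq mult.left_commute)
      qed (simp_all add: distrib_left self.subspace_0[OF P'(3)] self.subspace_add[OF P'(3)])
      have "?I \<subseteq> {x. b * x \<in> P}"
        by (rule self.span_minimal)
          (use sub ab self.subspace_scale[OF P'(3)] in \<open>auto simp: mult.commute\<close>)
      with that show ?thesis by blast
    qed
    ultimately have "b * 1 \<in> ideal_closure s P"
      by (intro ideal_closure_mult[OF I P'(1)]) auto
    then show ?thesis
      by (simp add: P'(2))
  qed
  then show ?thesis
    unfolding prime_ideal_def using P(2) P'(3) by blast
qed

lemma exists_star_maximal:
  assumes J: "star_ideal s J" "J \<noteq> UNIV"
  shows "\<exists>P. star_maximal s P \<and> J \<subseteq> P"
proof -
  have one: "I = UNIV" if "star_ideal s I" "1 \<in> I" for I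
  proof -
    have "x \<in> I" for x
      using self.subspace_scale[of I 1 x] that by (simp add: star_ideal_def)
    then show ?thesis by blast
  qed
  define A where "A = {I. star_ideal s I \<and> I \<noteq> UNIV \<and> J \<subseteq> I}"
  have "\<exists>P\<in>A. \<forall>I\<in>A. P \<subseteq> I \<longrightarrow> I = P"
  proof (rule subset_Zorn_nonempty)
    show "A \<noteq> {}"
      using J unfolding A_def by blast
  next
    fix C assume ne: "C \<noteq> {}" and chain: "subset.chain A C"
    have CA: "star_ideal s I" "I \<noteq> UNIV" "J \<subseteq> I" if "I \<in> C" for I
      using chain that unfolding subset_chain_def A_def by auto
    have star_U: "star_ideal s (\<Union>C)"
    proof (rule star_ideal_Union_chain[OF ne])
      show "I \<subseteq> K \<or> K \<subseteq> I" if "I \<in> C" "K \<in> C" for I K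
        using chain that unfolding subset_chain_def by blast
    qed (rule CA(1))
    moreover have "1 \<notin> \<Union>C"
      using CA(1,2) one by (metis UnionE)
    then have "\<Union>C \<noteq> UNIV"
      by (metis UNIV_I)
    moreover have "J \<subseteq> \<Union>C"
      using ne CA(3) by (meson Union_upper ex_in_conv subset_trans)
    ultimately show "\<Union>C \<in> A"
      by (simp add: A_def)
  qed
  then obtain P where P: "P \<in> A" and max': "\<forall>I\<in>A. P \<subseteq> I \<longrightarrow> I = P"
    by (elim bexE)
  then have P: "star_ideal s P" "P \<noteq> UNIV" "J \<subseteq> P"
    by (simp_all add: A_def)
  have max: "I = P" if "star_ideal s I" "I \<noteq> UNIV" "P \<subseteq> I" for I
    using max' that subset_trans[OF P(3) that(3)] by (simp add: A_def)
  have "prime_ideal P"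
    by (rule prime_if_maximal_proper_star_ideal) (use P max in auto)
  then have "star_maximal s P"
    using P max unfolding star_maximal_def star_prime_def prime_ideal_def by blast
  with P show ?thesis
    by blast
qed

end


section \<open>Superprimitive polynomials\<close>

text \<open>This is \<open>(R : c(g)) = R\<close> for the content ideal \<open>c(g)\<close> of \<open>g\<close>, which for \<open>g \<noteq> 0\<close> means
  \<open>c(g)\<^sub>v = R\<close>, with the fraction \<open>a / b\<close> that multiplies the content into \<open>R\<close> cleared of its denominator.\<close>

definition superprimitive :: "'r::idom poly \<Rightarrow> bool" where
  "superprimitive g \<longleftrightarrow> (\<forall>a b. b \<noteq> 0 \<longrightarrow> (\<forall>i. b dvd a * coeff g i) \<longrightarrow> b dvd a)"

text \<open>This is McCoy's theorem on annihilators, applied to polynomials over the \<open>R\<close>-module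
  \<open>R / bR\<close>: if \<open>g\<close> kills some \<open>h \<noteq> 0\<close>, then a single nonzero element of the module is killed by
  all coefficients of \<open>g\<close>. Superprimitivity excludes such an element. The induction is on a bound
  \<open>m\<close> for the degree of \<open>h\<close> modulo \<open>b\<close>. From the highest coefficient of \<open>g\<close> downwards, \<open>coeff g i\<close>
  kills the leading coefficient of \<open>h\<close>, so \<open>coeff g i\<close> times \<open>h\<close> has smaller degree, is again
  killed by \<open>g\<close>, and vanishes by induction.\<close>

lemma const_dvd_cancel_superprimitive:
  fixes g h :: "'r::idom poly"
  assumes g: "superprimitive g" and b: "b \<noteq> 0" and "[:b:] dvd g * h"
  shows "[:b:] dvd h"
proof -
  have "\<forall>i. b dvd coeff h i" if "\<forall>i\<ge>m. b dvd coeff h i" "[:b:] dvd g * h" for m h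
    using that
  proof (induction m arbitrary: h)
    case 0
    then show ?case by simp
  next
    case (Suc m)
    have step: "\<forall>j. b dvd coeff g i * coeff h j" for i
    proof (induction "Suc (degree g) - i" arbitrary: i rule: less_induct)
      case less
      have above: "b dvd coeff g k * coeff h j" if "k > i" for k j
      proof (cases "k \<le> degree g")
        case True
        then show ?thesis
          using less[of k] that by auto
      next
        case False
        then show ?thesis by (simp add: coeff_eq_0)
      qed
      \<comment> \<open>modulo \<open>b\<close>, this coefficient of \<open>g * h\<close> consists of the term \<open>coeff g i * coeff h m\<close> alone\<close>
      have "b dvd coeff (g * h) (i + m)"
        using Suc.prems(2) by (simp add: const_poly_dvd_iff)
      also have "coeff (g * h) (i + m) = (\<Sum>k\<le>i + m. coeff g k * coeff h (i + m - k))"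
        by (rule coeff_mult)
      also have "\<dots> = coeff g i * coeff h m +
          (\<Sum>k\<in>{..i + m} - {i}. coeff g k * coeff h (i + m - k))"
        by (subst sum.remove[of _ i]) auto
      finally have "b dvd \<dots>" .
      moreover have "b dvd (\<Sum>k\<in>{..i + m} - {i}. coeff g k * coeff h (i + m - k))"
      proof (rule dvd_sum)
        fix k assume "k \<in> {..i + m} - {i}"
        then consider "k > i" | "Suc m \<le> i + m - k"
          by fastforce
        then show "b dvd coeff g k * coeff h (i + m - k)"
          using above Suc.prems(1) by cases auto
      qed
      ultimately have im: "b dvd coeff g i * coeff h m"
        by (metis dvd_add_left_iff)
      have "\<forall>j. b dvd coeff (smult (coeff g i) h) j"
      proof (rule Suc.IH)
        show "\<forall>j\<ge>m. b dvd coeff (smult (coeff g i) h) j"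
          using im Suc.prems(1) by (metis coeff_smult dvd_mult le_neq_implies_less Suc_leI)
        show "[:b:] dvd g * smult (coeff g i) h"
          using Suc.prems(2) by (metis dvd_smult mult_smult_right)
      qed
      then show ?case by simp
    qed
    show ?case
    proof
      fix j
      show "b dvd coeff h j"
        using g b step[rule_format, of _ j] unfolding superprimitive_def
        by (metis mult.commute)
    qed
  qed
  from this[of "Suc (degree h)" h] show ?thesis
    using assms(3) by (simp add: const_poly_dvd_iff coeff_eq_0)
qed

lemma fract_poly_denominator:
  fixes h :: "'r::idom fract poly"
  obtains b h' where "b \<noteq> 0" "fract_poly h' = smult (to_fract b) h"
proof -
  have "\<exists>b h'. b \<noteq> 0 \<and> fract_poly h' = smult (to_fract b) h"
  proof (induction h)
    case 0
    show ?case
      by (intro exI[of _ 1] exI[of _ 0]) simp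
  next
    case (pCons c h)
    then obtain b h' where bh: "b \<noteq> 0" "fract_poly h' = smult (to_fract b) h"
      by blast
    obtain u v where uv: "c = Fract u v" "v \<noteq> 0"
      by (rule Fract_cases)
    have "to_fract (b * u) = to_fract (b * v) * c"
      using uv(2) unfolding uv(1) Fract_conv_to_fract by simp
    moreover have "fract_poly (smult v h') = smult (to_fract (b * v)) h"
      using bh(2) by (simp add: mult.commute)
    ultimately have "fract_poly (pCons (b * u) (smult v h')) = smult (to_fract (b * v)) (pCons c h)"
      by (simp only: map_poly_pCons to_fract_0 smult_pCons)
    then show ?case
      using bh(1) uv(2) by (intro exI[of _ "b * v"] exI) auto
  qed
  then show thesis
    using that by blast
qed

definition contraction :: "'r::idom fract poly \<Rightarrow> 'r poly set" where
  "contraction f = {g. fract_poly g \<in> range ((*) f)}"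

lemma mem_contraction_iff: "g \<in> contraction f \<longleftrightarrow> f dvd fract_poly g"
  by (auto simp: contraction_def dvd_def)

text \<open>Membership in \<open>g K[X] \<inter> R[X]\<close> expressed inside \<open>R[X]\<close>: the cofactor in \<open>K[X]\<close> is cleared of
  denominators.\<close>

lemma mem_contraction_fract_poly_iff:
  "w \<in> contraction (fract_poly g) \<longleftrightarrow> (\<exists>d. d \<noteq> 0 \<and> g dvd smult d w)"
proof
  assume "w \<in> contraction (fract_poly g)"
  then obtain h where h: "fract_poly w = fract_poly g * h"
    by (auto simp: mem_contraction_iff)
  obtain d h' where d: "d \<noteq> 0" "fract_poly h' = smult (to_fract d) h"
    using fract_poly_denominator .
  have "fract_poly (smult d w) = fract_poly (g * h')"
    using h d by simp
  then have "smult d w = g * h'"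
    by (simp only: fract_poly_eq_iff)
  then have "g dvd smult d w"
    by simp
  with d(1) show "\<exists>d. d \<noteq> 0 \<and> g dvd smult d w"
    by blast
next
  assume "\<exists>d. d \<noteq> 0 \<and> g dvd smult d w"
  then obtain d where d: "d \<noteq> 0" "g dvd smult d w"
    by blast
  then have "fract_poly g dvd smult (to_fract d) (fract_poly w)"
    using fract_poly_dvd[of g "smult d w"] by simp
  then show "w \<in> contraction (fract_poly g)"
    using d(1) by (simp add: mem_contraction_iff dvd_smult_iff)
qed

lemma contraction_eq_contraction_fract_poly:
  assumes "f \<noteq> 0"
  obtains g where "g \<noteq> 0" "contraction f = contraction (fract_poly g)"
proof -
  obtain d g where d: "d \<noteq> 0" "fract_poly g = smult (to_fract d) f"
    using fract_poly_denominator .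
  have "contraction f = contraction (fract_poly g)"
    using d(1) unfolding d(2) by (auto simp: mem_contraction_iff smult_dvd_iff)
  moreover have "g \<noteq> 0"
    using d assms by auto
  ultimately show thesis
    using that by blast
qed

text \<open>Gauss's lemma: the denominator \<open>d\<close> of the cofactor of \<open>g\<close> divides \<open>g * h\<close> and cancels
  against \<open>h\<close>.\<close>

lemma contraction_superprimitive:
  assumes "superprimitive g" "w \<in> contraction (fract_poly g)"
  shows "g dvd w"
proof -
  obtain d h where d: "d \<noteq> 0" "smult d w = g * h"
    using assms(2) unfolding mem_contraction_fract_poly_iff dvd_def by blast
  then have "[:d:] dvd g * h"
    by (intro dvdI[of _ _ w]) simp
  then have "[:d:] dvd h"
    by (rule const_dvd_cancel_superprimitive[OF assms(1) d(1)])
  then obtain h' where "h = [:d:] * h'" ..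
  then have "smult d w - smult d (g * h') = 0"
    using d(2) by simp
  then have "w - g * h' = 0"
    using d(1) unfolding smult_diff_right[symmetric] smult_eq_0_iff by blast
  then have "w = g * h'"
    by simp
  then show ?thesis
    by simp
qed

text \<open>Multiplying by a power of \<open>X\<close> beyond the degree of \<open>t\<close> keeps the coefficients of the summands
  apart. The sum thus has the content of the whole set and stays in the ideal.\<close>

lemma ideal_collecting_coeffs:
  fixes M :: "'r::idom poly set"
  assumes M: "self.subspace M" and "finite T" "T \<subseteq> M"
  obtains g where "g \<in> M" "\<And>t i. t \<in> T \<Longrightarrow> \<exists>j. coeff t i = coeff g j"
proof -
  have "\<exists>g\<in>M. \<forall>t\<in>T. \<forall>i. \<exists>j. coeff t i = coeff g j"
    using assms(2,3)
  proof (induction T rule: finite_induct)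
    case empty
    then show ?case
      using self.subspace_0[OF M] by blast
  next
    case (insert t T)
    then obtain g where g: "g \<in> M" "\<forall>t\<in>T. \<forall>i. \<exists>j. coeff t i = coeff g j"
      by blast
    define g' where "g' = t + monom 1 (Suc (degree t)) * g"
    have "g' \<in> M"
      unfolding g'_def
      by (intro self.subspace_add[OF M] self.subspace_scale[OF M]) (use insert g in auto)
    moreover have high: "coeff g' (Suc (degree t) + j) = coeff g j" for j
      by (simp add: g'_def coeff_monom_mult coeff_eq_0)
    moreover have "\<exists>j. coeff t i = coeff g' j" for i
    proof (cases "i \<le> degree t")
      case True
      then have "coeff t i = coeff g' i"
        by (simp add: g'_def coeff_monom_mult)
      then show ?thesis ..
    next
      case False
      \<comment> \<open>here \<open>coeff t i = 0\<close>, which also occurs in \<open>g'\<close>, beyond its degree\<close>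
      have "coeff g' (Suc (degree t) + Suc (degree g)) = 0"
        unfolding high by (simp add: coeff_eq_0)
      with False show ?thesis
        by (metis coeff_eq_0 not_le)
    qed
    moreover have "\<exists>j. coeff u i = coeff g' j" if "u \<in> T" for u i
      using g(2) that high by metis
    ultimately show ?case
      by (intro bexI[of _ g']) auto
  qed
  then show thesis
    using that by blast
qed

text \<open>A constant fraction \<open>a / b\<close> that multiplies all coefficients into \<open>R\<close> multiplies \<open>T\<close> into
  \<open>R[X]\<close>, hence it lies in \<open>R[X]\<close>, which means \<open>a / b \<in> R\<close>.\<close>

lemma superprimitive_if_one_in_v_op:
  fixes T :: "'r::idom poly set"
  assumes T: "1 \<in> v_op (to_fract ` T)"
    and g: "\<And>t i. t \<in> T \<Longrightarrow> \<exists>j. coeff t i = coeff g j"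
  shows "superprimitive g"
  unfolding superprimitive_def
proof (intro allI impI)
  fix a b :: 'r assume b: "b \<noteq> 0" and dvd: "\<forall>i. b dvd a * coeff g i"
  define y where "y = to_fract [:a:] / to_fract [:b:]"
  have "y * to_fract t \<in> range to_fract" if "t \<in> T" for t
  proof -
    have "b dvd coeff ([:a:] * t) i" for i
      using dvd g[OF that, of i] by auto
    then have "[:b:] dvd [:a:] * t"
      by (simp add: const_poly_dvd_iff)
    then obtain r where "[:a:] * t = [:b:] * r" ..
    then have "to_fract [:a:] * to_fract t = to_fract [:b:] * to_fract r"
      by (metis to_fract_mult)
    then have "y * to_fract t = to_fract r"
      using b by (simp add: y_def field_simps)
    then show ?thesis by simp
  qed
  then have "y \<in> colon (to_fract ` T)"
    by (auto simp: mem_colon_iff)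
  then have "1 * y \<in> range to_fract"
    using T unfolding v_op_def by (metis mem_colon_iff)
  then obtain r where "y = to_fract r"
    by auto
  then have "to_fract [:a:] = to_fract [:b:] * to_fract r"
    using b by (simp add: y_def field_simps)
  then have "[:a:] = [:b:] * r"
    unfolding to_fract_mult[symmetric] to_fract_eq_iff .
  then have "[:b:] dvd [:a:]"
    by (rule dvdI)
  then show "b dvd a"
    unfolding const_poly_dvd_iff by (metis coeff_pCons_0)
qed


section \<open>Uppers to zero\<close>

lemma subspace_contraction: "self.subspace (contraction f)"
  by (rule self.subspaceI) (auto simp: mem_contraction_iff)

lemma prime_ideal_contraction:
  assumes f: "irreducible f"
  shows "prime_ideal (contraction f)"
proof -
  have pr: "prime_elem f"
    using f by (rule field_poly_irreducible_imp_prime)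
  have "1 \<notin> contraction f"
    using irreducible_not_unit[OF f] by (simp add: mem_contraction_iff)
  moreover have "a \<in> contraction f \<or> b \<in> contraction f" if "a * b \<in> contraction f" for a b
    using that prime_elem_dvd_multD[OF pr] by (simp add: mem_contraction_iff)
  ultimately show ?thesis
    using subspace_contraction unfolding prime_ideal_def by blast
qed

lemma upper_to_zero_iff: "upper_to_zero Q \<longleftrightarrow> (\<exists>f. irreducible f \<and> Q = contraction f)"
  using prime_ideal_contraction unfolding upper_to_zero_def contraction_def by blast

lemma common_denominator:
  assumes "finite T" "T \<subseteq> contraction (fract_poly g)"
  obtains d where "d \<noteq> 0" "\<And>t. t \<in> T \<Longrightarrow> g dvd smult d t"
proof -
  have "\<exists>d. d \<noteq> 0 \<and> (\<forall>t\<in>T. g dvd smult d t)"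
    using assms
  proof (induction T rule: finite_induct)
    case empty
    show ?case
      by (intro exI[of _ 1]) simp
  next
    case (insert t T)
    then obtain d e where d: "d \<noteq> 0" "\<forall>u\<in>T. g dvd smult d u" "e \<noteq> 0" "g dvd smult e t"
      by (auto simp: mem_contraction_fract_poly_iff)
    have "g dvd smult (d * e) u" if "u \<in> T" for u
      using d(2) that dvd_smult[of g "smult d u" e] by (simp add: mult.commute)
    moreover have "g dvd smult (d * e) t"
      using dvd_smult[OF d(4), of d] by simp
    ultimately show ?case
      using d(1,3) by (intro exI[of _ "d * e"]) simp
  qed
  then show thesis
    using that by blast
qed

text \<open>Let \<open>d\<close> be a common denominator of the cofactors of a finite set \<open>T \<subseteq> g K[X] \<inter> R[X]\<close>. Then
  \<open>d / g\<close> multiplies \<open>T\<close> into \<open>R[X]\<close>, so it multiplies \<open>T\<^sub>v\<close> into \<open>R[X]\<close>, and therefore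
  \<open>T\<^sub>v \<subseteq> (g / d) R[X] \<subseteq> g K[X]\<close>.\<close>

lemma t_ideal_contraction:
  assumes f: "f \<noteq> 0"
  shows "star_ideal t_op (contraction f)"
proof -
  obtain g where g: "g \<noteq> 0" "contraction f = contraction (fract_poly g)"
    using contraction_eq_contraction_fract_poly[OF f] .
  have "g \<in> contraction f"
    by (simp add: g(2) mem_contraction_iff)
  then have ideal: "nonzero_ideal (contraction f)"
    using g(1) subspace_contraction by (auto simp: nonzero_ideal_def)
  have "x \<in> contraction f" if x: "x \<in> ideal_closure t_op (contraction f)" for x
  proof -
    obtain T where T: "finite T" "T \<subseteq> contraction f" "to_fract x \<in> v_op (to_fract ` T)"
      using t.ideal_closure_finite[OF ideal x] by metis
    obtain d where d: "d \<noteq> 0" "\<And>t. t \<in> T \<Longrightarrow> g dvd smult d t"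
      using common_denominator[of T g] T g(2) by metis
    define y where "y = to_fract [:d:] / to_fract g"
    have y: "y * to_fract w \<in> range to_fract \<longleftrightarrow> g dvd smult d w" for w
    proof -
      have "y * to_fract w = to_fract r \<longleftrightarrow> smult d w = g * r" for r
      proof -
        have "y * to_fract w = to_fract r \<longleftrightarrow>
            to_fract [:d:] * to_fract w = to_fract g * to_fract r"
          using g(1) by (simp add: y_def field_simps)
        also have "\<dots> \<longleftrightarrow> [:d:] * w = g * r"
          unfolding to_fract_mult[symmetric] to_fract_eq_iff ..
        finally show ?thesis
          by simp
      qed
      then show ?thesis
        by (auto simp: dvd_def)
    qed
    have "y \<in> colon (to_fract ` T)"
      using d(2) by (auto simp: mem_colon_iff y simp del: image_iff)
    then have "y * to_fract x \<in> range to_fract"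
      using T(3) unfolding v_op_def by (metis mem_colon_iff mult.commute)
    then show ?thesis
      using d(1) by (auto simp: y g(2) mem_contraction_fract_poly_iff)
  qed
  then show ?thesis
    using ideal t.subset_ideal_closure[OF ideal] by (auto simp: t.star_ideal_iff)
qed

text \<open>For \<open>f = p q\<close> the product of the contractions of \<open>p\<close> and \<open>q\<close> lies in the contraction of
  \<open>f\<close>, so a prime ideal that contains the latter contains one of the former.\<close>

lemma contains_contraction_of_irreducible:
  assumes M: "prime_ideal M" and "f \<noteq> 0" "contraction f \<subseteq> M"
  shows "\<exists>f'. irreducible f' \<and> contraction f' \<subseteq> M"
  using assms(2,3)
proof (induction "degree f" arbitrary: f rule: less_induct)
  case less
  have "\<not> f dvd 1"
  proof
    assume "f dvd 1"
    then have "contraction f = UNIV"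
      by (auto simp: mem_contraction_iff intro: unit_imp_dvd)
    then show False
      using M less.prems by (auto simp: prime_ideal_def)
  qed
  show ?case
  proof (cases "irreducible f")
    case True
    then show ?thesis using less.prems by blast
  next
    case False
    then obtain p q where pq: "f = p * q" "\<not> p dvd 1" "\<not> q dvd 1"
      using less.prems \<open>\<not> f dvd 1\<close> unfolding irreducible_def by blast
    have "p \<noteq> 0" "q \<noteq> 0"
      using pq less.prems by auto
    then have "degree p < degree f" "degree q < degree f"
      using pq is_unit_iff_degree[of p] is_unit_iff_degree[of q] by (auto simp: degree_mult_eq)
    moreover have "contraction p \<subseteq> M \<or> contraction q \<subseteq> M"
    proof (rule ccontr)
      assume "\<not> (contraction p \<subseteq> M \<or> contraction q \<subseteq> M)"
      then obtain a b where ab: "a \<in> contraction p" "b \<in> contraction q" "a \<notin> M" "b \<notin> M"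
        by blast
      then have "a * b \<in> contraction f"
        by (simp add: mem_contraction_iff pq(1) mult_dvd_mono)
      then show False
        using less.prems ab M by (auto simp: prime_ideal_def)
    qed
    ultimately show ?thesis
      using less.hyps \<open>p \<noteq> 0\<close> \<open>q \<noteq> 0\<close> by blast
  qed
qed


section \<open>Comparison of the maximal spectra\<close>

text \<open>A prime ideal whose \<open>t\<close>-closure is everything contains a superprimitive polynomial \<open>g\<close>, hence all
  of \<open>g K[X] \<inter> R[X] = g R[X]\<close>, hence the contraction of an irreducible factor of \<open>g\<close>.\<close>

lemma contains_upper_if_t_closure_improper:
  fixes M :: "'r::idom poly set"
  assumes M: "prime_ideal M" "nonzero_ideal M" and one: "1 \<in> ideal_closure t_op M"
  shows "\<exists>Q. upper_to_zero Q \<and> Q \<subseteq> M"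
proof -
  have sub: "self.subspace M"
    using M(2) by (simp add: nonzero_ideal_def)
  obtain T where T: "finite T" "T \<subseteq> M" "nonzero_ideal (self.span T)" "to_fract 1 \<in> v_op (to_fract ` T)"
    using t.ideal_closure_finite[OF M(2) one] by metis
  obtain g where g: "g \<in> M" "\<And>t i. t \<in> T \<Longrightarrow> \<exists>j. coeff t i = coeff g j"
    using ideal_collecting_coeffs[OF sub T(1,2)] by metis
  have sp: "superprimitive g"
    using superprimitive_if_one_in_v_op[of T g] T(4) g(2) by simp
  have "g \<noteq> 0"
  proof
    assume "g = 0"
    then have "T \<subseteq> {0}"
      using g(2) by (auto simp: poly_eq_iff)
    then have "self.span T = {0}"
      using self.span_minimal[of T "{0}"] self.span_zero[of T] self.subspace_single_0 by blast
    then show False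
      using T(3) by (simp add: nonzero_ideal_def)
  qed
  moreover have "contraction (fract_poly g) \<subseteq> M"
  proof
    fix w assume "w \<in> contraction (fract_poly g)"
    then have "g dvd w"
      by (rule contraction_superprimitive[OF sp])
    then obtain u where "w = g * u" ..
    then show "w \<in> M"
      using self.subspace_scale[OF sub g(1), of u] by (simp add: mult.commute)
  qed
  ultimately obtain f where "irreducible f" "contraction f \<subseteq> M"
    using contains_contraction_of_irreducible[OF M(1), of "fract_poly g"] by auto
  then show ?thesis
    by (auto simp: upper_to_zero_iff)
qed

text \<open>A \<open>t\<close>-maximal ideal is a \<open>*\<close>-ideal, so it lies in a \<open>*\<close>-maximal one; that one is a
  \<open>t\<close>-prime by assumption, so the two coincide.\<close>

lemma (in finite_star) t_Max_eq_star_Max_if_star_maximals_t_ideals: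
  assumes "\<And>M. star_maximal s M \<Longrightarrow> star_ideal t_op M"
  shows "star_Max t_op = star_Max s"
proof -
  have "star_maximal s M \<longleftrightarrow> star_maximal t_op M" for M
  proof
    assume "star_maximal s M"
    then show "star_maximal t_op M"
      using assms[of M] star_ideal_if_t_ideal unfolding star_maximal_def star_prime_def by blast
  next
    assume M: "star_maximal t_op M"
    then have "star_ideal s M" "M \<noteq> UNIV"
      using star_ideal_if_t_ideal by (auto simp: star_maximal_def star_prime_def prime_ideal_def)
    then obtain N where N: "star_maximal s N" "M \<subseteq> N"
      using exists_star_maximal by blast
    then have "N = M"
      using assms[OF N(1)] M unfolding star_maximal_def star_prime_def by blast
    with N(1) show "star_maximal s M"
      by simp
  qed
  then show ?thesis
    by (auto simp: star_Max_def)
qed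

text \<open>A proper \<open>t\<close>-closure is a \<open>*\<close>-ideal, so it lies in a \<open>*\<close>-maximal ideal, and that ideal
  contains \<open>M\<close>.\<close>

lemma (in finite_star) star_maximal_t_ideal_if_t_closure_proper:
  assumes M: "star_maximal s M" and proper: "1 \<notin> ideal_closure t_op M"
  shows "star_ideal t_op M"
proof -
  have ideal: "nonzero_ideal M"
    using M by (auto simp: star_maximal_def star_prime_def star_ideal_iff)
  let ?J = "ideal_closure t_op M"
  have J: "star_ideal t_op ?J" "M \<subseteq> ?J" "?J \<noteq> UNIV"
    using t.star_ideal_ideal_closure[OF ideal] t.subset_ideal_closure[OF ideal] proper by auto
  then obtain N where "star_maximal s N" "?J \<subseteq> N"
    using exists_star_maximal[OF star_ideal_if_t_ideal] by blast
  then have "?J = M"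
    using M J(2) unfolding star_maximal_def by blast
  with J(1) show ?thesis
    by simp
qed

theorem theorem2p9:
  fixes s :: "'r::idom poly fract set \<Rightarrow> 'r poly fract set"
  assumes "star_operation s" and "finite_character s"
  shows "(\<forall>Q. upper_to_zero Q \<longrightarrow> star_maximal s Q) \<longleftrightarrow>
         UMT_domain TYPE('r) \<and> star_Max (t_op :: 'r poly fract set \<Rightarrow> 'r poly fract set) = star_Max s"
proof
  interpret finite_star s
    using assms by unfold_locales
  assume upper: "\<forall>Q. upper_to_zero Q \<longrightarrow> star_maximal s Q"
  have upper_t: "star_ideal t_op Q" if "upper_to_zero Q" for Q :: "'r poly set"
    using that t_ideal_contraction by (auto simp: upper_to_zero_iff irreducible_def)
  have "star_ideal t_op M" if M: "star_maximal s M" for M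
  proof (cases "1 \<in> ideal_closure t_op M")
    case True
    then obtain Q where Q: "upper_to_zero Q" "Q \<subseteq> M"
      using M contains_upper_if_t_closure_improper[of M]
      by (auto simp: star_maximal_def star_prime_def star_ideal_iff)
    then have "M = Q"
      using M upper unfolding star_maximal_def by blast
    then show ?thesis
      using upper_t Q(1) by simp
  next
    case False
    then show ?thesis
      using star_maximal_t_ideal_if_t_closure_proper[OF M] by blast
  qed
  then have "star_Max t_op = star_Max s"
    by (rule t_Max_eq_star_Max_if_star_maximals_t_ideals)
  moreover have "UMT_domain TYPE('r)"
    unfolding UMT_domain_def
    using upper calculation by (auto simp: star_Max_def)
  ultimately show "UMT_domain TYPE('r) \<and> star_Max t_op = star_Max s"
    by blast
next
  assume "UMT_domain TYPE('r) \<and> star_Max t_op = star_Max s"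
  then show "\<forall>Q. upper_to_zero Q \<longrightarrow> star_maximal s Q"
    unfolding UMT_domain_def star_Max_def by blast
qed

end
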